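(* Let $n\ge 1$ and $0\le m<n$ be integers, and let $H(n,m)$ be the group defined by the presentation $$H(n,m)=\langle x_0,\dots,x_{n-1}\mid x_i x_{i+m}=x_{i+1}\ (0\le i<n)\rangle,$$ with subscripts taken modulo $n$. Then the abelianization satisfies $H(n,m)^{\mathrm{ab}}\cong\mathbb{Z}^2$ if and only if $n\equiv 0\pmod 6$ and $m\equiv 2\pmod n$.
   Context: The groups $H(n,m)$ are called Gilbert--Howie groups. $H^{\mathrm{ab}}$ denotes the abelianization $H/[H,H]$. *)

theory Defs
  imports "HOL-Algebra.Generated_Groups" "HOL-Algebra.Elementary_Groups" "HOL-Number_Theory.Cong"
begin

section \<open>Free groups\<close>

text \<open>A word over the generating set \<open>X\<close> is a list of letters; the letter \<open>(x, True)\<close> stands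
  for \<open>x\<close> and \<open>(x, False)\<close> for its formal inverse.\<close>

type_synonym 'a word = "('a \<times> bool) list"

definition words :: "'a set \<Rightarrow> 'a word set" where
  "words X = lists (X \<times> UNIV)"

inductive_set free_eq :: "'a set \<Rightarrow> ('a word \<times> 'a word) set" for X :: "'a set" where
  refl: "u \<in> words X \<Longrightarrow> (u, u) \<in> free_eq X"
| cancel: "\<lbrakk>u \<in> words X; v \<in> words X; x \<in> X\<rbrakk>
    \<Longrightarrow> (u @ [(x, b), (x, \<not> b)] @ v, u @ v) \<in> free_eq X"
| sym: "(u, v) \<in> free_eq X \<Longrightarrow> (v, u) \<in> free_eq X"
| trans: "\<lbrakk>(u, v) \<in> free_eq X; (v, w) \<in> free_eq X\<rbrakk> \<Longrightarrow> (u, w) \<in> free_eq X"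

definition free_group :: "'a set \<Rightarrow> 'a word set monoid" where
  "free_group X =
    \<lparr>carrier = words X // free_eq X,
     monoid.mult = (\<lambda>A B. \<Union>u\<in>A. \<Union>v\<in>B. free_eq X `` {u @ v}),
     one = free_eq X `` {[]}\<rparr>"

definition free_gen :: "'a set \<Rightarrow> 'a \<Rightarrow> 'a word set" where
  "free_gen X x = free_eq X `` {[(x, True)]}"

lemma words_Nil [simp]: "[] \<in> words X"
  by (simp add: words_def)

lemma words_append [simp]: "u @ v \<in> words X \<longleftrightarrow> u \<in> words X \<and> v \<in> words X"
  by (auto simp: words_def)

lemma words_Cons [simp]: "a # v \<in> words X \<longleftrightarrow> fst a \<in> X \<and> v \<in> words X"
  by (cases a) (auto simp: words_def)

lemma free_eq_words:
  assumes "(u, v) \<in> free_eq X"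
  shows "u \<in> words X" "v \<in> words X"
  using assms by (induction rule: free_eq.induct) auto

lemma equiv_free_eq: "equiv (words X) (free_eq X)"
proof (rule equivI)
  show "free_eq X \<subseteq> words X \<times> words X"
    using free_eq_words by auto
  show "refl_on (words X) (free_eq X)"
    by (auto simp: refl_on_def intro: free_eq.refl)
  show "sym (free_eq X)"
    by (auto intro: symI free_eq.sym)
  show "trans (free_eq X)"
    by (auto intro: transI free_eq.trans)
qed

lemma free_eq_append_right:
  assumes "(u, u') \<in> free_eq X" "v \<in> words X"
  shows "(u @ v, u' @ v) \<in> free_eq X"
  using assms
proof (induction rule: free_eq.induct)
  case (cancel u w x b)
  then show ?case
    using free_eq.cancel[of u X "w @ v" x b] by simp
qed (auto intro: free_eq.intros)

lemma free_eq_append_left: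
  assumes "(v, v') \<in> free_eq X" "u \<in> words X"
  shows "(u @ v, u @ v') \<in> free_eq X"
  using assms
proof (induction rule: free_eq.induct)
  case (cancel w v x b)
  then show ?case
    using free_eq.cancel[of "u @ w" X v x b] by simp
qed (auto intro: free_eq.intros)

lemma free_eq_append:
  assumes "(u, u') \<in> free_eq X" "(v, v') \<in> free_eq X"
  shows "(u @ v, u' @ v') \<in> free_eq X"
  using free_eq_append_right[OF assms(1)] free_eq_append_left[OF assms(2)] free_eq_words assms
  by (meson free_eq.trans)

lemma free_group_mult:
  assumes "u \<in> words X" "v \<in> words X"
  shows "free_eq X `` {u} \<otimes>\<^bsub>free_group X\<^esub> free_eq X `` {v} = free_eq X `` {u @ v}"
proof -
  have "congruent2 (free_eq X) (free_eq X) (\<lambda>u v. free_eq X `` {u @ v})"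
    by (auto simp: congruent2_def intro!: equiv_class_eq[OF equiv_free_eq] free_eq_append)
  then show ?thesis
    using UN_equiv_class2[OF equiv_free_eq equiv_free_eq _ assms]
    by (simp add: free_group_def)
qed

lemma free_group_carrierE:
  assumes "A \<in> carrier (free_group X)"
  obtains u where "u \<in> words X" "A = free_eq X `` {u}"
  using assms by (auto simp: free_group_def elim: quotientE)

lemma free_group_carrierI: "u \<in> words X \<Longrightarrow> free_eq X `` {u} \<in> carrier (free_group X)"
  by (simp add: free_group_def quotientI)

lemma free_eq_inverse:
  "u \<in> words X \<Longrightarrow> (rev (map (\<lambda>(x, b). (x, \<not> b)) u) @ u, []) \<in> free_eq X"
proof (induction u)
  case Nil
  then show ?case by (auto intro: free_eq.refl)
next
  case (Cons a u)
  obtain x b where a: "a = (x, b)" by force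
  let ?w = "rev (map (\<lambda>(x, b). (x, \<not> b)) u)"
  have w: "?w \<in> words X" and u: "u \<in> words X"
    using Cons free_eq_words(1) by fastforce+
  have "(?w @ [(x, \<not> b), (x, \<not> \<not> b)] @ u, ?w @ u) \<in> free_eq X"
    using Cons.prems a w u by (intro free_eq.cancel) auto
  with Cons.IH[OF u] show ?case
    by (auto simp: a intro: free_eq.trans)
qed

lemma group_free_group: "group (free_group X)"
proof (rule groupI)
  have one: "\<one>\<^bsub>free_group X\<^esub> = free_eq X `` {[]}"
    by (simp add: free_group_def)
  then show "\<one>\<^bsub>free_group X\<^esub> \<in> carrier (free_group X)"
    by (simp add: free_group_carrierI)
  fix A assume "A \<in> carrier (free_group X)"
  then obtain u where u: "u \<in> words X" and A: "A = free_eq X `` {u}"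
    by (rule free_group_carrierE)
  show "\<one>\<^bsub>free_group X\<^esub> \<otimes>\<^bsub>free_group X\<^esub> A = A"
    using u by (simp add: A one free_group_mult)
  show "\<exists>B\<in>carrier (free_group X). B \<otimes>\<^bsub>free_group X\<^esub> A = \<one>\<^bsub>free_group X\<^esub>"
  proof
    let ?v = "rev (map (\<lambda>(x, b). (x, \<not> b)) u)"
    have v: "?v \<in> words X"
      using free_eq_words(1)[OF free_eq_inverse[OF u]] by simp
    then show "free_eq X `` {?v} \<in> carrier (free_group X)"
      by (rule free_group_carrierI)
    show "free_eq X `` {?v} \<otimes>\<^bsub>free_group X\<^esub> A = \<one>\<^bsub>free_group X\<^esub>"
      using free_group_mult[OF v u] equiv_class_eq[OF equiv_free_eq free_eq_inverse[OF u]]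
      by (simp add: A one)
  qed
  fix B assume "B \<in> carrier (free_group X)"
  then obtain v where v: "v \<in> words X" and B: "B = free_eq X `` {v}"
    by (rule free_group_carrierE)
  show "A \<otimes>\<^bsub>free_group X\<^esub> B \<in> carrier (free_group X)"
    using u v by (simp add: A B free_group_mult free_group_carrierI)
  fix C assume "C \<in> carrier (free_group X)"
  then obtain w where w: "w \<in> words X" and C: "C = free_eq X `` {w}"
    by (rule free_group_carrierE)
  show "A \<otimes>\<^bsub>free_group X\<^esub> B \<otimes>\<^bsub>free_group X\<^esub> C = A \<otimes>\<^bsub>free_group X\<^esub> (B \<otimes>\<^bsub>free_group X\<^esub> C)"
    using u v w by (simp add: A B C free_group_mult)
qed

lemma free_gen_closed: "x \<in> X \<Longrightarrow> free_gen X x \<in> carrier (free_group X)"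
  by (simp add: free_gen_def free_group_carrierI)

section \<open>Presentations\<close>

definition normal_closure :: "('a, 'b) monoid_scheme \<Rightarrow> 'a set \<Rightarrow> 'a set" where
  "normal_closure G R =
    generate G (\<Union>g\<in>carrier G. \<Union>r\<in>R. {g \<otimes>\<^bsub>G\<^esub> r \<otimes>\<^bsub>G\<^esub> inv\<^bsub>G\<^esub> g})"

lemma (in group) normal_normal_closure:
  assumes "R \<subseteq> carrier G"
  shows "normal_closure G R \<lhd> G"
  unfolding normal_closure_def
proof (rule normal_generateI)
  show "(\<Union>g\<in>carrier G. \<Union>r\<in>R. {g \<otimes> r \<otimes> inv g}) \<subseteq> carrier G"
    using assms by auto
  fix h g
  assume "h \<in> (\<Union>g\<in>carrier G. \<Union>r\<in>R. {g \<otimes> r \<otimes> inv g})" and g: "g \<in> carrier G"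
  then obtain k r where k: "k \<in> carrier G" and r: "r \<in> R" and h: "h = k \<otimes> r \<otimes> inv k"
    by auto
  have "r \<in> carrier G" using r assms by auto
  then have "g \<otimes> h \<otimes> inv g = (g \<otimes> k) \<otimes> r \<otimes> inv (g \<otimes> k)"
    using g k by (simp add: h inv_mult_group m_assoc)
  then show "g \<otimes> h \<otimes> inv g \<in> (\<Union>g\<in>carrier G. \<Union>r\<in>R. {g \<otimes> r \<otimes> inv g})"
    using g k r by blast
qed

text \<open>The group with generators \<open>X\<close> and relators \<open>R \<subseteq> carrier (free_group X)\<close>; a relation
  \<open>u = v\<close> is encoded by the relator \<open>u v\<^sup>-\<^sup>1\<close>.\<close>

definition presented_group :: "'a set \<Rightarrow> 'a word set set \<Rightarrow> 'a word set set monoid" where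
  "presented_group X R = free_group X Mod normal_closure (free_group X) R"

lemma group_presented_group:
  "R \<subseteq> carrier (free_group X) \<Longrightarrow> group (presented_group X R)"
  unfolding presented_group_def
  by (intro normal.factorgroup_is_group group.normal_normal_closure group_free_group)

definition abelianization :: "('a, 'b) monoid_scheme \<Rightarrow> 'a set monoid" where
  "abelianization G = G Mod derived G (carrier G)"

lemma (in group) comm_group_abelianization: "comm_group (abelianization G)"
  unfolding abelianization_def by (rule derived_quot_is_comm_group)

section \<open>Gilbert--Howie groups\<close>

definition gilbert_howie_relators :: "nat \<Rightarrow> nat \<Rightarrow> nat word set set" where
  "gilbert_howie_relators n m =
    (let F = free_group {..<n}; x = (\<lambda>i. free_gen {..<n} (i mod n))
     in {x i \<otimes>\<^bsub>F\<^esub> x (i + m) \<otimes>\<^bsub>F\<^esub> inv\<^bsub>F\<^esub> x (i + 1) |i. i < n})"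

definition gilbert_howie :: "nat \<Rightarrow> nat \<Rightarrow> nat word set set monoid" where
  "gilbert_howie n m = presented_group {..<n} (gilbert_howie_relators n m)"

lemma gilbert_howie_relators_closed:
  "gilbert_howie_relators n m \<subseteq> carrier (free_group {..<n})"
proof -
  interpret group "free_group {..<n}" by (rule group_free_group)
  show ?thesis
    by (auto simp: gilbert_howie_relators_def Let_def
        intro!: m_closed inv_closed free_gen_closed)
qed

lemma group_gilbert_howie: "group (gilbert_howie n m)"
  unfolding gilbert_howie_def
  by (rule group_presented_group[OF gilbert_howie_relators_closed])

end

theory Submission
  imports Defs Complex_Main "HOL-Computational_Algebra.Polynomial"
begin

text \<open>The abelianization is the additive group of \<open>\<int>[t] / (t^n - 1, 1 - t + t^m)\<close>. If it is
  \<open>\<int>\<^sup>2\<close>, multiplication by \<open>t\<close> is a \<open>2 \<times> 2\<close> integer matrix. An eigenvalue \<open>z\<close> has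
  \<open>\<bar>z\<bar> = \<bar>z - 1\<bar> = 1\<close>, hence is a primitive sixth root of unity; so \<open>6\<close> divides \<open>n\<close>,
  \<open>m \<equiv> 2 (mod 6)\<close>, and \<open>1 - t + t^2\<close> lies in the ideal.

  To exclude \<open>m \<noteq> 2\<close>, put \<open>t = -X\<close> and \<open>N = n / 2\<close> and pass to \<open>R = \<int>[X] / (X^N + 1)\<close>, where
  \<open>1 + X + X^2\<close> is not a zero divisor because it divides \<open>X^N - 1 = -2\<close>. Here
  \<open>1 + X + X^m = (1 + X + X^2) g\<close> with \<open>g\<close> a unit. For the involution \<open>X \<mapsto> X^(-1)\<close> the unit
  \<open>w = bar g / g\<close> satisfies \<open>w * bar w = 1\<close>, so the squares of its coefficients add up to \<open>1\<close> and
  \<open>w\<close> is a signed power of \<open>X\<close>. Therefore \<open>1 + X + X^m\<close> agrees with its image under the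
  involution up to such a factor, and comparing exponents leaves only \<open>m = 2\<close>.\<close>

section \<open>Abelianized presentations\<close>

fun eval_word :: "('b, 'c) monoid_scheme \<Rightarrow> ('a \<Rightarrow> 'b) \<Rightarrow> 'a word \<Rightarrow> 'b" where
  "eval_word G f [] = \<one>\<^bsub>G\<^esub>"
| "eval_word G f ((x, b) # w) = (if b then f x else inv\<^bsub>G\<^esub> f x) \<otimes>\<^bsub>G\<^esub> eval_word G f w"

context group
begin

lemma eval_word_closed:
  assumes "f \<in> A \<rightarrow> carrier G" "w \<in> words A"
  shows "eval_word G f w \<in> carrier G"
  using assms(2) by (induction w) (use assms(1) in \<open>auto simp: Pi_iff\<close>)

lemma eval_word_append:
  assumes "f \<in> A \<rightarrow> carrier G" "v \<in> words A" "w \<in> words A"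
  shows "eval_word G f (v @ w) = eval_word G f v \<otimes> eval_word G f w"
  using assms(2)
proof (induction v)
  case (Cons a v)
  then show ?case
    using assms eval_word_closed[OF assms(1)] by (cases a) (auto simp: m_assoc Pi_iff)
qed (simp add: eval_word_closed[OF assms(1,3)])

lemma eval_word_free_eq:
  assumes f: "f \<in> A \<rightarrow> carrier G" and "(v, w) \<in> free_eq A"
  shows "eval_word G f v = eval_word G f w"
  using assms(2)
proof (induction rule: free_eq.induct)
  case (cancel u v x b)
  have "f x \<in> carrier G" using f cancel by auto
  moreover have "eval_word G f v \<in> carrier G" using f cancel eval_word_closed by blast
  ultimately have "eval_word G f ([(x, b), (x, \<not> b)] @ v) = eval_word G f v"
    by (cases b) (simp_all flip: m_assoc)
  then show ?case
    using cancel eval_word_append[OF f, of u "[(x, b), (x, \<not> b)] @ v"] eval_word_append[OF f, of u v]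
    by simp
qed auto

lemma free_group_universal:
  assumes f: "f \<in> A \<rightarrow> carrier G"
  obtains h where "h \<in> hom (free_group A) G" "\<And>x. x \<in> A \<Longrightarrow> h (free_gen A x) = f x"
proof -
  \<comment> \<open>A representative of the class is chosen with \<open>SOME\<close>; by
    \<open>eval_word_free_eq\<close> every representative has the same value.\<close>
  define h where "h C = eval_word G f (SOME w. w \<in> C)" for C
  have h: "h (free_eq A `` {w}) = eval_word G f w" if "w \<in> words A" for w
  proof -
    have "w \<in> free_eq A `` {w}" using that by (auto intro: free_eq.refl)
    then have "(w, SOME v. v \<in> free_eq A `` {w}) \<in> free_eq A"
      using someI[of "\<lambda>v. v \<in> free_eq A `` {w}" w] by simp
    then show ?thesis unfolding h_def using eval_word_free_eq[OF f] by metis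
  qed
  show thesis
  proof
    show "h \<in> hom (free_group A) G"
    proof (rule homI)
      fix B C assume "B \<in> carrier (free_group A)" "C \<in> carrier (free_group A)"
      then show "h B \<in> carrier G" "h (B \<otimes>\<^bsub>free_group A\<^esub> C) = h B \<otimes> h C"
        using f by (auto elim!: free_group_carrierE
            simp: h free_group_mult eval_word_append eval_word_closed)
    qed
    show "h (free_gen A x) = f x" if "x \<in> A" for x
      using that f by (simp add: free_gen_def h Pi_iff)
  qed
qed

end

lemma free_group_hom_eqI:
  assumes G: "group G" and f: "f \<in> hom (free_group A) G" and g: "g \<in> hom (free_group A) G"
    and eq: "\<And>x. x \<in> A \<Longrightarrow> f (free_gen A x) = g (free_gen A x)"
    and C: "C \<in> carrier (free_group A)"
  shows "f C = g C"
proof -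
  interpret f: group_hom "free_group A" G f
    using G f by (simp add: group_hom_def group_hom_axioms_def group_free_group)
  interpret g: group_hom "free_group A" G g
    using G g by (simp add: group_hom_def group_hom_axioms_def group_free_group)
  let ?c = "\<lambda>w. free_eq A `` {w}"
  have letter: "f (?c [(x, b)]) = g (?c [(x, b)])" if x: "x \<in> A" for x b
  proof (cases b)
    case True
    then show ?thesis using eq[OF x] by (simp add: free_gen_def)
  next
    case False
    \<comment> \<open>Recognizing the class of an inverse letter as the inverse of
      \<open>free_gen A x\<close> extends the agreement of \<open>f\<close> and \<open>g\<close>
      from generators to all letters.\<close>
    have "?c [(x, False)] \<otimes>\<^bsub>free_group A\<^esub> ?c [(x, True)] = \<one>\<^bsub>free_group A\<^esub>"
      using x free_eq_inverse[of "[(x, True)]" A]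
      by (simp add: free_group_mult) (simp add: free_group_def equiv_class_eq[OF equiv_free_eq])
    then have "?c [(x, False)] = inv\<^bsub>free_group A\<^esub> free_gen A x"
      unfolding free_gen_def using x
      by (intro f.G.inv_equality[symmetric]) (auto intro: free_group_carrierI)
    then show ?thesis
      using False eq x by (simp add: free_gen_closed)
  qed
  obtain w where w: "w \<in> words A" "C = ?c w" using C by (rule free_group_carrierE)
  have "f (?c w) = g (?c w)" using w(1)
  proof (induction w)
    case Nil
    have "?c [] = \<one>\<^bsub>free_group A\<^esub>" by (simp add: free_group_def)
    then show ?case by simp
  next
    case (Cons a w)
    obtain x b where a: "a = (x, b)" by force
    have x: "x \<in> A" "w \<in> words A" using Cons.prems a by auto
    have "?c (a # w) = ?c [a] \<otimes>\<^bsub>free_group A\<^esub> ?c w"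
      using x by (simp add: a free_group_mult)
    then show ?case
      using Cons.IH[OF x(2)] letter[OF x(1), of b] x
      by (simp add: a free_group_carrierI)
  qed
  then show ?thesis using w by simp
qed

definition abel_gen :: "'a set \<Rightarrow> 'a word set set \<Rightarrow> 'a \<Rightarrow> 'a word set set set" where
  "abel_gen A R x = derived (presented_group A R) (carrier (presented_group A R))
     #>\<^bsub>presented_group A R\<^esub> (normal_closure (free_group A) R #>\<^bsub>free_group A\<^esub> free_gen A x)"

locale presentation =
  fixes A :: "'a set" and R :: "'a word set set"
  assumes relators: "R \<subseteq> carrier (free_group A)"
begin

abbreviation "F \<equiv> free_group A"
abbreviation "P \<equiv> presented_group A R"
abbreviation "ab \<equiv> abelianization P"

text \<open>Elements of \<open>ab\<close> are cosets of cosets of word classes. The composite of the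
  two quotient maps lets later arguments bypass the intermediate group \<open>P\<close>.\<close>

definition proj where
  "proj C = derived P (carrier P) #>\<^bsub>P\<^esub> (normal_closure F R #>\<^bsub>F\<^esub> C)"

lemma abel_gen_eq: "abel_gen A R x = proj (free_gen A x)"
  by (simp add: abel_gen_def proj_def)

sublocale F: group F by (rule group_free_group)
sublocale P: group P by (rule group_presented_group[OF relators])
sublocale ab: comm_group ab by (rule P.comm_group_abelianization)

lemma normal_closure_normal: "normal_closure F R \<lhd> F"
  by (rule F.normal_normal_closure[OF relators])

lemma carrier_ab: "carrier ab = proj ` carrier F"
  by (simp add: proj_def abelianization_def carrier_FactGroup presented_group_def image_image)

lemma proj_hom: "proj \<in> hom F ab"
proof -
  have "(\<lambda>C. normal_closure F R #>\<^bsub>F\<^esub> C) \<in> hom F P"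
    unfolding presented_group_def by (rule normal.r_coset_hom_Mod[OF normal_closure_normal])
  moreover have "(\<lambda>C. derived P (carrier P) #>\<^bsub>P\<^esub> C) \<in> hom P ab"
    unfolding abelianization_def by (rule normal.r_coset_hom_Mod[OF P.derived_self_is_normal])
  ultimately show ?thesis
    by (simp add: proj_def[abs_def] hom_compose[of _ F P _ ab, unfolded comp_def])
qed

lemma abel_gen_closed: "x \<in> A \<Longrightarrow> abel_gen A R x \<in> carrier ab"
  by (simp add: abel_gen_eq carrier_ab free_gen_closed)

lemma proj_relator:
  assumes "r \<in> R"
  shows "proj r = \<one>\<^bsub>ab\<^esub>"
proof -
  interpret N: normal "normal_closure F R" F by (rule normal_closure_normal)
  interpret D: normal "derived P (carrier P)" P by (rule P.derived_self_is_normal)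
  have r: "r \<in> carrier F" using assms relators by auto
  then have "\<one>\<^bsub>F\<^esub> \<otimes>\<^bsub>F\<^esub> r \<otimes>\<^bsub>F\<^esub> inv\<^bsub>F\<^esub> \<one>\<^bsub>F\<^esub> \<in> normal_closure F R"
    unfolding normal_closure_def by (intro generate.incl UN_I[of "\<one>\<^bsub>F\<^esub>"] UN_I[OF assms]) simp_all
  then have "r \<in> normal_closure F R" using r by simp
  then have "normal_closure F R #>\<^bsub>F\<^esub> r = normal_closure F R"
    by (simp add: F.coset_join2 N.subgroup_axioms r)
  also have "\<dots> = \<one>\<^bsub>P\<^esub>" by (simp add: presented_group_def)
  finally show ?thesis
    by (simp add: proj_def abelianization_def P.coset_mult_one D.subset)
qed

text \<open>The map factors in two stages: its kernel contains all conjugates of relators, hence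
  their normal closure, and the induced map on \<open>P\<close> kills commutators because
  \<open>G\<close> is commutative.\<close>

lemma ab_universal:
  assumes G: "comm_group G" and h: "h \<in> hom F G" and rel: "\<And>r. r \<in> R \<Longrightarrow> h r = \<one>\<^bsub>G\<^esub>"
  obtains g where "g \<in> hom ab G" "\<And>C. C \<in> carrier F \<Longrightarrow> g (proj C) = h C"
proof -
  interpret G: comm_group G by (rule G)
  interpret h: group_hom F G h by unfold_locales (rule h)
  have "normal_closure F R \<subseteq> kernel F G h"
    unfolding normal_closure_def
  proof (rule F.generate_subgroup_incl[OF _ h.subgroup_kernel])
    show "(\<Union>g\<in>carrier F. \<Union>r\<in>R. {g \<otimes>\<^bsub>F\<^esub> r \<otimes>\<^bsub>F\<^esub> inv\<^bsub>F\<^esub> g}) \<subseteq> kernel F G h"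
    proof clarify
      fix g r assume "g \<in> carrier F" "r \<in> R"
      moreover from this have "r \<in> carrier F" "h r = \<one>\<^bsub>G\<^esub>" using relators rel by blast+
      ultimately show "g \<otimes>\<^bsub>F\<^esub> r \<otimes>\<^bsub>F\<^esub> inv\<^bsub>F\<^esub> g \<in> kernel F G h" by (simp add: kernel_def)
    qed
  qed
  then obtain h' where h': "h' \<in> hom P G" "\<And>C. C \<in> carrier F \<Longrightarrow> h' (normal_closure F R #>\<^bsub>F\<^esub> C) = h C"
    by (rule h.FactGroup_universal_kernel[OF normal_closure_normal, folded presented_group_def]) blast
  interpret h': group_hom P G h' by unfold_locales (rule h'(1))
  have "derived P (carrier P) \<subseteq> kernel P G h'"
    unfolding derived_def
  proof (rule P.generate_subgroup_incl[OF _ h'.subgroup_kernel])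
    show "derived_set P (carrier P) \<subseteq> kernel P G h'"
    proof clarify
      fix a b assume ab: "a \<in> carrier P" "b \<in> carrier P"
      have "h' a \<otimes>\<^bsub>G\<^esub> h' b \<otimes>\<^bsub>G\<^esub> inv\<^bsub>G\<^esub> h' a \<otimes>\<^bsub>G\<^esub> inv\<^bsub>G\<^esub> h' b
          = (h' a \<otimes>\<^bsub>G\<^esub> h' b) \<otimes>\<^bsub>G\<^esub> inv\<^bsub>G\<^esub> (h' a \<otimes>\<^bsub>G\<^esub> h' b)"
        using ab by (simp only: G.inv_mult G.m_assoc h'.hom_closed G.inv_closed G.m_closed)
      also have "\<dots> = \<one>\<^bsub>G\<^esub>" using ab by (intro G.r_inv) simp
      finally have "h' a \<otimes>\<^bsub>G\<^esub> h' b \<otimes>\<^bsub>G\<^esub> inv\<^bsub>G\<^esub> h' a \<otimes>\<^bsub>G\<^esub> inv\<^bsub>G\<^esub> h' b = \<one>\<^bsub>G\<^esub>" .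
      then show "a \<otimes>\<^bsub>P\<^esub> b \<otimes>\<^bsub>P\<^esub> inv\<^bsub>P\<^esub> a \<otimes>\<^bsub>P\<^esub> inv\<^bsub>P\<^esub> b \<in> kernel P G h'"
        using ab by (simp add: kernel_def)
    qed
  qed
  then obtain g where g: "g \<in> hom ab G" "\<And>C. C \<in> carrier P \<Longrightarrow> g (derived P (carrier P) #>\<^bsub>P\<^esub> C) = h' C"
    by (rule h'.FactGroup_universal_kernel[OF P.derived_self_is_normal, folded abelianization_def]) blast
  have "normal_closure F R #>\<^bsub>F\<^esub> C \<in> carrier P" if "C \<in> carrier F" for C
    using that by (simp add: presented_group_def carrier_FactGroup)
  then show thesis
    using that[of g] g h'(2) by (simp add: proj_def)
qed

lemma ab_hom_eqI:
  assumes G: "group G" and f: "f \<in> hom ab G" and g: "g \<in> hom ab G"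
    and eq: "\<And>x. x \<in> A \<Longrightarrow> f (abel_gen A R x) = g (abel_gen A R x)"
    and z: "z \<in> carrier ab"
  shows "f z = g z"
proof -
  obtain C where C: "C \<in> carrier F" "z = proj C" using z by (auto simp: carrier_ab)
  have "(f \<circ> proj) C = (g \<circ> proj) C"
    by (rule free_group_hom_eqI[OF G hom_compose[OF proj_hom f] hom_compose[OF proj_hom g] _ C(1)])
      (use eq in \<open>simp add: abel_gen_eq\<close>)
  then show ?thesis using C by simp
qed

end

text \<open>The index is reduced modulo \<open>n\<close>, so that the generators form a sequence on all of \<open>nat\<close>.\<close>

definition gh_gen :: "nat \<Rightarrow> nat \<Rightarrow> nat \<Rightarrow> nat word set set set" where
  "gh_gen n m i = abel_gen {..<n} (gilbert_howie_relators n m) (i mod n)"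

section \<open>Generators, relations and universal property of the abelianized group\<close>

locale gilbert_howie_ab =
  fixes n m :: nat
  assumes n_pos: "n \<ge> 1"
begin

sublocale presentation "{..<n}" "gilbert_howie_relators n m"
  by unfold_locales (rule gilbert_howie_relators_closed)

abbreviation H where "H \<equiv> abelianization (gilbert_howie n m)"
abbreviation x where "x \<equiv> gh_gen n m"

lemma H_eq: "H = ab"
  by (simp add: gilbert_howie_def)

sublocale H: comm_group H
  unfolding H_eq by (rule ab.comm_group_axioms)

lemma gen_closed [simp]: "x i \<in> carrier H"
  unfolding H_eq gh_gen_def using n_pos by (intro abel_gen_closed) auto

lemma gen_mod [simp]: "x (i mod n) = x i"
  by (simp add: gh_gen_def)

lemma gen_period: "x (i + n) = x i"
  by (simp add: gh_gen_def)

lemma gen_cong: "[i = j] (mod n) \<Longrightarrow> x i = x j"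
  by (simp add: gh_gen_def cong_def)

text \<open>Only indices below \<open>n\<close> give relators; reducing \<open>i\<close> first and
  using periodicity covers the rest.\<close>

lemma gen_relation: "x i \<otimes>\<^bsub>H\<^esub> x (i + m) = x (i + 1)"
proof -
  let ?y = "\<lambda>j. free_gen {..<n} (j mod n)"
  let ?i = "i mod n"
  have y: "?y j \<in> carrier F" for j using n_pos by (intro free_gen_closed) auto
  have "?y ?i \<otimes>\<^bsub>F\<^esub> ?y (?i + m) \<otimes>\<^bsub>F\<^esub> inv\<^bsub>F\<^esub> ?y (?i + 1) \<in> gilbert_howie_relators n m"
    unfolding gilbert_howie_relators_def Let_def using n_pos by (intro CollectI exI[of _ ?i]) auto
  from proj_relator[OF this]
  have eq: "proj (?y ?i \<otimes>\<^bsub>F\<^esub> ?y (?i + m) \<otimes>\<^bsub>F\<^esub> inv\<^bsub>F\<^esub> ?y (?i + 1)) = \<one>\<^bsub>H\<^esub>"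
    unfolding H_eq .
  interpret p: group_hom F H proj
    unfolding H_eq by unfold_locales (rule proj_hom)
  have py: "proj (?y j) = x j" for j by (simp add: gh_gen_def abel_gen_eq)
  have "x ?i \<otimes>\<^bsub>H\<^esub> x (?i + m) \<otimes>\<^bsub>H\<^esub> inv\<^bsub>H\<^esub> x (?i + 1) = \<one>\<^bsub>H\<^esub>"
    using eq by (simp only: p.hom_mult p.hom_inv F.m_closed F.inv_closed y py)
  then have "x ?i \<otimes>\<^bsub>H\<^esub> x (?i + m) = \<one>\<^bsub>H\<^esub> \<otimes>\<^bsub>H\<^esub> x (?i + 1)"
    using H.inv_solve_right[OF H.one_closed H.m_closed[OF gen_closed gen_closed] gen_closed] by metis
  then have "x ?i \<otimes>\<^bsub>H\<^esub> x (?i + m) = x (?i + 1)"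
    by (simp only: H.l_one gen_closed)
  moreover have "x (?i + m) = x (i + m)" "x (?i + 1) = x (i + 1)"
    by (rule gen_cong; simp add: cong_def mod_simps)+
  ultimately show ?thesis by simp
qed

lemma gen_hom_eqI:
  assumes "group G" "f \<in> hom H G" "g \<in> hom H G" "\<And>i. f (x i) = g (x i)" "z \<in> carrier H"
  shows "f z = g z"
proof (rule ab_hom_eqI)
  show "f (abel_gen {..<n} (gilbert_howie_relators n m) i) = g (abel_gen {..<n} (gilbert_howie_relators n m) i)"
    if "i \<in> {..<n}" for i
    using assms(4)[of i] that by (simp add: gh_gen_def)
qed (use assms in \<open>simp_all add: H_eq\<close>)

text \<open>All homomorphisms out of \<open>H\<close> come from here: the index shift, the map to a
  quotient of the polynomial ring and the map to Z^2.\<close>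

lemma gen_universal:
  assumes G: "comm_group G" and b: "\<And>i. b i \<in> carrier G"
    and period: "\<And>i. b (i mod n) = b i"
    and rel: "\<And>i. b i \<otimes>\<^bsub>G\<^esub> b (i + m) = b (i + 1)"
  obtains h where "h \<in> hom H G" "\<And>i. h (x i) = b i"
proof -
  interpret G: comm_group G by (rule G)
  obtain f where f: "f \<in> hom F G" "\<And>i. i < n \<Longrightarrow> f (free_gen {..<n} i) = b i"
    using G.free_group_universal[of b "{..<n}"] b by auto
  interpret f: group_hom F G f by unfold_locales (rule f(1))
  have fy: "f (free_gen {..<n} (i mod n)) = b i" for i
    using f(2)[of "i mod n"] n_pos period by simp
  have y: "free_gen {..<n} (j mod n) \<in> carrier F" for j using n_pos by (intro free_gen_closed) auto
  have "f r = \<one>\<^bsub>G\<^esub>" if r: "r \<in> gilbert_howie_relators n m" for r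
  proof -
    let ?y = "\<lambda>j. free_gen {..<n} (j mod n)"
    obtain i where "r = ?y i \<otimes>\<^bsub>F\<^esub> ?y (i + m) \<otimes>\<^bsub>F\<^esub> inv\<^bsub>F\<^esub> ?y (i + 1)"
      using r unfolding gilbert_howie_relators_def Let_def by blast
    then have "f r = b i \<otimes>\<^bsub>G\<^esub> b (i + m) \<otimes>\<^bsub>G\<^esub> inv\<^bsub>G\<^esub> b (i + 1)"
      by (simp only: f.hom_mult f.hom_inv F.m_closed F.inv_closed y fy)
    also have "\<dots> = \<one>\<^bsub>G\<^esub>"
      unfolding rel using b by simp
    finally show ?thesis .
  qed
  then obtain g where g: "g \<in> hom ab G" "\<And>C. C \<in> carrier F \<Longrightarrow> g (proj C) = f C"
    by (elim ab_universal[OF G f(1)]) (rule that)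
  show thesis
  proof
    show "g \<in> hom H G" unfolding H_eq by (rule g(1))
    show "g (x i) = b i" for i
      using g(2)[OF y] fy by (simp add: gh_gen_def abel_gen_eq)
  qed
qed

end

section \<open>Periodic solutions of the recurrence\<close>

text \<open>The unit circles about 0 and 1 meet only at the two points with real part 1/2. Powers of
  such a \<open>z\<close> have period 6, so \<open>n\<close> and \<open>m\<close> matter only modulo
  6.\<close>

lemma sixth_root_of_unity:
  fixes z :: complex
  assumes n: "n \<ge> 1" "z ^ n = 1" and m: "1 + z ^ m = z"
  shows "z\<^sup>2 = z - 1" and "Im z \<noteq> 0" and "6 dvd n" and "m mod 6 = 2"
proof -
  have nz: "norm z = 1" using power_eq_1_iff[OF n(2)] n(1) by simp
  have "z - 1 = z ^ m" using m by (simp add: algebra_simps)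
  then have "norm (z - 1) = 1" using nz by (simp add: norm_power)
  then have eqs: "(Re z)\<^sup>2 + (Im z)\<^sup>2 = 1" "(Re z - 1)\<^sup>2 + (Im z)\<^sup>2 = 1"
    using nz cmod_power2[of z] cmod_power2[of "z - 1"] by simp_all
  then have re: "Re z = 1 / 2" by (simp add: power2_eq_square algebra_simps)
  then have im: "(Im z)\<^sup>2 = 3 / 4" using eqs(1) unfolding re by (simp add: power2_eq_square)
  then show im0: "Im z \<noteq> 0" by auto
  show sq: "z\<^sup>2 = z - 1"
    by (simp add: complex_eq_iff Re_power2 Im_power2 re im power_divide)
  have z3: "z ^ 3 = -1"
  proof -
    have "z ^ 3 = z\<^sup>2 * z" by (simp add: power2_eq_square power3_eq_cube)
    also have "\<dots> = (z - 1) * z" by (simp only: sq)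
    also have "\<dots> = z\<^sup>2 - z" by (simp add: power2_eq_square algebra_simps)
    also have "\<dots> = -1" unfolding sq by simp
    finally show ?thesis .
  qed
  have z4: "z ^ 4 = - z" and z5: "z ^ 5 = 1 - z" and z6: "z ^ 6 = 1"
    using z3 sq power_add[of z 3 1] power_add[of z 3 2] power_add[of z 3 3] by simp_all
  have red: "z ^ e = z ^ (e mod 6)" for e
  proof -
    have "z ^ e = (z ^ 6) ^ (e div 6) * z ^ (e mod 6)" by (simp flip: power_mult power_add)
    then show ?thesis by (simp add: z6)
  qed
  have six: "e mod 6 \<in> {0, 1, 2, 3, 4, 5}" for e :: nat by auto
  \<comment> \<open>A wrong residue is either absurd outright or yields a linear equation with real
    coefficients for the non-real \<open>z\<close>.\<close>
  have real: "a * z \<noteq> b" if "a \<in> \<real>" "b \<in> \<real>" "a \<noteq> 0" for a b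
    using that im0 by (auto simp: complex_eq_iff elim!: Reals_cases)
  have "n mod 6 = 0"
    using six[of n] red[of n] n(2) real[of 1 1] real[of 1 2] real[of "-1" 1] real[of 1 0]
    by (auto simp: sq z3 z4 z5 algebra_simps)
  then show "6 dvd n" by auto
  have "z ^ (m mod 6) = z - 1" using m red[of m] by (simp add: algebra_simps)
  then show "m mod 6 = 2"
    using six[of m] real[of 1 1] real[of 1 2] real[of 1 0] real[of 2 1] 
    by (auto simp: sq z3 z4 z5 algebra_simps)
qed

text \<open>If \<open>t\<^sup>2 - a t + d\<close> has the roots \<open>l\<close> and \<open>r\<close>, then \<open>u (i + 1) - r u i\<close> is geometric
  with ratio \<open>l\<close>; should it vanish, \<open>u\<close> itself is geometric with ratio \<open>r\<close>.\<close>

lemma periodic_trinomial_recurrence: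
  fixes u :: "nat \<Rightarrow> int" and a d :: int
  assumes rec: "\<And>i. u (i + 2) = a * u (i + 1) - d * u i"
    and n: "n \<ge> 1" "\<And>i. u (i + n) = u i" and rel: "\<And>i. u i + u (i + m) = u (i + 1)"
    and "u 0 \<noteq> 0"
  shows "a = 1" "d = 1" "6 dvd n" "m mod 6 = 2"
proof -
  \<comment> \<open>Working over the complex numbers covers negative discriminants as well as a
    double root \<open>l = r\<close>.\<close>
  define w where "w = csqrt ((of_int a)\<^sup>2 - 4 * of_int d)"
  define l r where "l = (of_int a + w) / 2" and "r = (of_int a - w) / 2"
  have w2: "w\<^sup>2 = (of_int a)\<^sup>2 - 4 * of_int d" by (simp add: w_def)
  have sum: "l + r = of_int a" by (simp add: l_def r_def field_simps)
  have prod: "l * r = of_int d"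
    using w2 by (simp add: l_def r_def field_simps power2_eq_square)
  have roots: "z\<^sup>2 - of_int a * z + of_int d = 0" if "z = l \<or> z = r" for z
    using that unfolding sum[symmetric] prod[symmetric] by (auto simp: power2_eq_square algebra_simps)
  define U :: "nat \<Rightarrow> complex" where "U i = of_int (u i)" for i
  have U: "U (i + 2) = (l + r) * U (i + 1) - (l * r) * U i" "U (i + n) = U i"
    "U i + U (i + m) = U (i + 1)" for i
    unfolding U_def sum prod of_int_add[symmetric] of_int_diff[symmetric] of_int_mult[symmetric]
    by (simp_all only: rec n(2) rel)
  obtain c z where c: "c 0 \<noteq> 0" "\<And>i. c (Suc i) = z * c i" "c n = c 0" "c 0 + c m = c 1"
    and z: "z = l \<or> z = r"
  proof (cases "U 1 = r * U 0")
    case False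
    define c where "c i = U (i + 1) - r * U i" for i
    show thesis
    proof (rule that[of c l])
      show "c 0 \<noteq> 0" using False by (simp add: c_def)
      show "c (Suc i) = l * c i" for i using U(1)[of i] by (simp add: c_def algebra_simps)
      show "c n = c 0" using U(2)[of 0] U(2)[of 1] by (simp add: c_def)
      have "r * (U 0 + U m) = r * U 1" using U(3)[of 0] by simp
      then show "c 0 + c m = c 1" using U(3)[of 0] U(3)[of 1] by (simp add: c_def algebra_simps)
    qed simp
  next
    case True
    have step: "U (Suc i) = r * U i" for i
    proof (induction i)
      case (Suc i)
      then show ?case using U(1)[of i] by (simp add: algebra_simps)
    qed (use True in simp)
    show thesis
      using that[of U r] step U(2)[of 0] U(3)[of 0] \<open>u 0 \<noteq> 0\<close> by (simp add: U_def)
  qed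
  have pow: "c i = z ^ i * c 0" for i by (induction i) (simp_all add: c(2))
  have zn: "z ^ n = 1" using pow[of n] c(1,3) by simp
  have "(1 + z ^ m) * c 0 = z * c 0"
    using c(4) c(2)[of 0] pow[of m] by (simp add: algebra_simps)
  then have zm: "1 + z ^ m = z" using c(1) by simp
  note six = sixth_root_of_unity[OF n(1) zn zm]
  show "6 dvd n" "m mod 6 = 2" by (rule six)+
  have "z - 1 - of_int a * z + of_int d = 0"
    using roots[OF z] six(1) by simp
  \<comment> \<open>Comparing with z^2 - z + 1 = 0 leaves a linear equation with integer
    coefficients; since \<open>z\<close> is not real, both sides vanish.\<close>
  then have eq: "(1 - of_int a) * z = 1 - of_int d" by (simp add: algebra_simps)
  from arg_cong[OF this, of Im] have "(1 - of_int a) * Im z = (0 :: real)" by simp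
  then show "a = 1" using six(2) by simp
  then show "d = 1" using eq by simp
qed

section \<open>Endomorphisms of Z^2\<close>

lemma additive_int:
  fixes f :: "int \<Rightarrow> int"
  assumes "\<And>a b. f (a + b) = f a + f b"
  shows "f a = a * f 1"
proof (induction a rule: int_induct[where k = 0])
  case base
  show ?case using assms[of 0 0] by simp
next
  case (step1 i)
  then show ?case using assms[of i 1] by (simp add: algebra_simps)
next
  case (step2 i)
  then show ?case using assms[of "i - 1" 1] by (simp add: algebra_simps)
qed

text \<open>This supplies the matrix of the index shift, and later identifies an endomorphism as the
  identity from its values on the unit vectors.\<close>

lemma hom_integer_group_square:
  assumes "h \<in> hom (integer_group \<times>\<times> integer_group) (integer_group \<times>\<times> integer_group)"
  obtains p q r s where "\<And>a b. h (a, b) = (p * a + q * b, r * a + s * b)"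
proof -
  have add: "h (a + c, b + d) = (fst (h (a, b)) + fst (h (c, d)), snd (h (a, b)) + snd (h (c, d)))"
    for a b c d
    using hom_mult[OF assms, of "(a, b)" "(c, d)"] by (simp add: mult_DirProd')
  have add1: "fst (h (a + c, 0)) = fst (h (a, 0)) + fst (h (c, 0))"
    "snd (h (a + c, 0)) = snd (h (a, 0)) + snd (h (c, 0))" for a c
    using add[of a c 0 0] by simp_all
  have add2: "fst (h (0, b + d)) = fst (h (0, b)) + fst (h (0, d))"
    "snd (h (0, b + d)) = snd (h (0, b)) + snd (h (0, d))" for b d
    using add[of 0 0 b d] by simp_all
  have split: "h (a, b) = (fst (h (a, 0)) + fst (h (0, b)), snd (h (a, 0)) + snd (h (0, b)))" for a b
    using add[of a 0 0 b] by simp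
  have lin1: "fst (h (a, 0)) = a * fst (h (1, 0))" "snd (h (a, 0)) = a * snd (h (1, 0))" for a
    by (rule additive_int[of "\<lambda>a. fst (h (a, 0))", OF add1(1)],
        rule additive_int[of "\<lambda>a. snd (h (a, 0))", OF add1(2)])
  have lin2: "fst (h (0, b)) = b * fst (h (0, 1))" "snd (h (0, b)) = b * snd (h (0, 1))" for b
    by (rule additive_int[of "\<lambda>b. fst (h (0, b))", OF add2(1)],
        rule additive_int[of "\<lambda>b. snd (h (0, b))", OF add2(2)])
  have "h (a, b) = (fst (h (1, 0)) * a + fst (h (0, 1)) * b,
      snd (h (1, 0)) * a + snd (h (0, 1)) * b)" for a b
    by (subst split) (simp only: lin1[of a] lin2[of b] mult.commute)
  then show thesis by (rule that)
qed

section \<open>The ring of integer polynomials modulo X^N + 1\<close>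

text \<open>Pseudo-division scales the dividend by a power of the leading coefficient, so for monic
  \<open>M\<close> it is genuine division. Positive degree of \<open>M\<close> takes care of a zero
  remainder.\<close>

lemma monic_int_poly_division:
  fixes M :: "int poly"
  assumes "lead_coeff M = 1" "degree M > 0"
  obtains r where "M dvd p - r" "degree r < degree M"
proof -
  have M: "M \<noteq> 0" using assms by auto
  obtain q r where qr: "pseudo_divmod p M = (q, r)" by force
  have "p = M * q + r" "r = 0 \<or> degree r < degree M"
    using pseudo_divmod[OF M qr] assms(1) by simp_all
  then show ?thesis
    using assms(2) by (intro that[of r]) auto
qed

lemma sum_squares_eq_1_int:
  fixes w :: "'a \<Rightarrow> int"
  assumes "finite A" "(\<Sum>i\<in>A. (w i)\<^sup>2) = 1"
  obtains i where "i \<in> A" "w i = 1 \<or> w i = -1" "\<And>j. \<lbrakk>j \<in> A; j \<noteq> i\<rbrakk> \<Longrightarrow> w j = 0"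
proof -
  have "\<exists>i\<in>A. w i \<noteq> 0"
    using assms(2) by (rule contrapos_pp) simp
  then obtain i where i: "i \<in> A" "w i \<noteq> 0" by blast
  have eq: "(w i)\<^sup>2 + (\<Sum>j\<in>A - {i}. (w j)\<^sup>2) = 1"
    using assms i by (simp add: sum.remove)
  have pos: "(w i)\<^sup>2 \<ge> 1" using i(2) by (simp add: int_one_le_iff_zero_less)
  have nn: "(\<Sum>j\<in>A - {i}. (w j)\<^sup>2) \<ge> 0" by (simp add: sum_nonneg)
  have "(\<Sum>j\<in>A - {i}. (w j)\<^sup>2) = 0" and "(w i)\<^sup>2 = 1" using eq pos nn by linarith+
  then show ?thesis
    using that[of i] i(1) assms(1) by (auto simp: sum_nonneg_eq_0_iff power2_eq_1_iff)
qed

locale negacyclic =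
  fixes N :: nat
  assumes N_pos: "N > 0"
begin

definition modulus :: "int poly" where
  "modulus = monom 1 N + 1"

text \<open>The quotient ring is handled by congruence of representatives; each class has exactly
  one of degree below \<open>N\<close> (\<open>eqv_reduce\<close>,
  \<open>eqv_imp_eq\<close>).\<close>

definition eqv :: "int poly \<Rightarrow> int poly \<Rightarrow> bool" (infix "\<approx>" 50) where
  "p \<approx> q \<longleftrightarrow> modulus dvd p - q"

definition X :: "int poly" where "X = monom 1 1"

text \<open>Since X^N is -1 in the quotient, this is the inverse of \<open>X\<close> there
  (\<open>X_Y\<close>).\<close>

definition Y :: "int poly" where "Y = - monom 1 (N - 1)"

text \<open>On polynomials this is only a ring endomorphism; it becomes an involution on classes
  (\<open>bar_cong\<close>, \<open>bar_bar\<close>).\<close>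

definition bar :: "int poly \<Rightarrow> int poly" where "bar p = pcompose p Y"

lemma eqv_refl [simp]: "p \<approx> p"
  by (simp add: eqv_def)

lemma eqv_sym: "p \<approx> q \<Longrightarrow> q \<approx> p"
  unfolding eqv_def by (subst dvd_minus_iff[symmetric]) simp

lemma eqv_trans [trans]: "p \<approx> q \<Longrightarrow> q \<approx> r \<Longrightarrow> p \<approx> r"
  unfolding eqv_def using dvd_add[of modulus "p - q" "q - r"] by simp

lemma eqv_add: "p \<approx> p' \<Longrightarrow> q \<approx> q' \<Longrightarrow> p + q \<approx> p' + q'"
  unfolding eqv_def using dvd_add[of modulus "p - p'" "q - q'"] by (simp add: algebra_simps)

lemma eqv_uminus: "p \<approx> p' \<Longrightarrow> - p \<approx> - p'"
  unfolding eqv_def using dvd_minus_iff[of modulus "p - p'"] by (simp add: algebra_simps)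

lemma eqv_mult:
  assumes "p \<approx> p'" "q \<approx> q'"
  shows "p * q \<approx> p' * q'"
proof -
  have "p * q - p' * q' = (p - p') * q + p' * (q - q')" by (simp add: algebra_simps)
  then show ?thesis using assms by (simp add: eqv_def)
qed

lemma eqv_power: "p \<approx> p' \<Longrightarrow> p ^ k \<approx> p' ^ k"
  by (induction k) (auto intro: eqv_mult)

lemma eqv_smult: "p \<approx> p' \<Longrightarrow> smult c p \<approx> smult c p'"
  unfolding eqv_def by (simp flip: smult_diff_right add: dvd_smult)

lemma eqv_sum: "(\<And>i. i \<in> A \<Longrightarrow> f i \<approx> g i) \<Longrightarrow> sum f A \<approx> sum g A"
  by (induction A rule: infinite_finite_induct) (auto intro: eqv_add)

lemma degree_modulus [simp]: "degree modulus = N"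
  unfolding modulus_def using N_pos by (subst degree_add_eq_left) (auto simp: degree_monom_eq)

lemma lead_coeff_modulus: "lead_coeff modulus = 1"
  using N_pos unfolding degree_modulus by (simp add: modulus_def)

lemma eqv_reduce:
  obtains r where "p \<approx> r" "degree r < N"
  using monic_int_poly_division[OF lead_coeff_modulus, of p] N_pos that by (auto simp: eqv_def)

lemma eqv_imp_eq:
  assumes "p \<approx> q" "degree p < N" "degree q < N"
  shows "p = q"
proof (rule ccontr)
  assume "p \<noteq> q"
  then have "degree modulus \<le> degree (p - q)"
    using assms(1) by (intro dvd_imp_degree_le) (auto simp: eqv_def)
  then show False
    using degree_diff_less[OF assms(2,3)] by simp
qed

text \<open>The quotient is torsion-free: scaling a remainder of degree below \<open>N\<close> keeps
  its degree below \<open>N\<close>, so a multiple that is congruent to 0 is 0.\<close>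

lemma eqv_cancel_smult:
  assumes "smult c p \<approx> smult c q" "c \<noteq> 0"
  shows "p \<approx> q"
proof -
  obtain r where r: "p - q \<approx> r" "degree r < N" by (rule eqv_reduce)
  have "smult c r \<approx> 0"
    using eqv_smult[OF r(1), of c] assms(1)
    by (metis eqv_def eqv_sym eqv_trans smult_diff_right diff_zero)
  then have "smult c r = 0"
    using r(2) N_pos by (intro eqv_imp_eq) (auto intro: le_less_trans[OF degree_smult_le])
  then show ?thesis
    using r(1) assms(2) by (simp add: eqv_def)
qed

lemma X_power: "X ^ k = monom 1 k"
  by (simp add: X_def monom_power)

lemma X_power_N: "X ^ N \<approx> -1"
  by (simp add: X_power eqv_def modulus_def)

lemma X_Y: "X * Y \<approx> 1"
proof -
  have "X * Y = - monom 1 N"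
    using N_pos by (simp add: X_def Y_def mult_monom)
  then have "X * Y - 1 = - modulus" by (simp add: modulus_def)
  then show ?thesis by (simp add: eqv_def)
qed

lemma X_Y_power: "X ^ k * Y ^ k \<approx> 1"
  using eqv_power[OF X_Y, of k] by (simp add: power_mult_distrib)

lemma Y_power_N: "Y ^ N \<approx> -1"
proof -
  have "1 \<approx> X ^ N * Y ^ N" by (rule eqv_sym[OF X_Y_power])
  also have "\<dots> \<approx> -1 * Y ^ N" by (intro eqv_mult X_power_N eqv_refl)
  finally show ?thesis using eqv_sym[OF eqv_uminus, of 1 "- (Y ^ N)"] by simp
qed

lemma X_Y_power_le: "j \<le> i \<Longrightarrow> X ^ i * Y ^ j \<approx> X ^ (i - j)"
  using eqv_mult[OF eqv_refl[of "X ^ (i - j)"] X_Y_power[of j]]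
  by (simp flip: mult.assoc power_add)

text \<open>Multiplying by -X^N, which is congruent to 1, makes the exponent difference nonnegative
  at the cost of a sign.\<close>

lemma X_Y_power_less:
  assumes "i < j" "j < N"
  shows "X ^ i * Y ^ j \<approx> - (X ^ (N + i - j))"
proof -
  have "X ^ i * Y ^ j \<approx> - (-1) * (X ^ i * Y ^ j)" by simp
  also have "\<dots> \<approx> - (X ^ N) * (X ^ i * Y ^ j)"
    by (intro eqv_mult eqv_uminus eqv_sym[OF X_power_N] eqv_refl)
  also have "- (X ^ N) * (X ^ i * Y ^ j) = - (X ^ (N + i) * Y ^ j)"
    by (simp add: power_add mult.assoc)
  also have "\<dots> \<approx> - (X ^ (N + i - j))"
    using assms by (intro eqv_uminus X_Y_power_le) simp
  finally show ?thesis .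
qed

section \<open>The involution inverting X\<close>

lemma bar_add: "bar (p + q) = bar p + bar q"
  and bar_mult: "bar (p * q) = bar p * bar q"
  and bar_1 [simp]: "bar 1 = 1"
  and bar_X [simp]: "bar X = Y"
  by (simp_all add: bar_def pcompose_add pcompose_mult pcompose_1 X_def monom_altdef pcompose_pCons)

lemma bar_power: "bar (p ^ k) = bar p ^ k"
  by (induction k) (simp_all add: bar_mult)

lemma bar_monom: "bar (monom c k) = smult c (Y ^ k)"
  using bar_power[of X k] bar_X
  by (simp add: bar_def monom_altdef pcompose_smult X_def)

lemma bar_sum: "bar (sum f A) = (\<Sum>i\<in>A. bar (f i))"
  by (simp add: bar_def pcompose_sum)

text \<open>Substitution preserves divisibility, and \<open>bar modulus\<close> is Y^N + 1, itself a
  multiple of \<open>modulus\<close>.\<close>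

lemma bar_cong:
  assumes "p \<approx> q"
  shows "bar p \<approx> bar q"
proof -
  have "bar modulus \<approx> 0"
    using eqv_add[OF Y_power_N eqv_refl[of 1]] by (simp add: modulus_def bar_add bar_monom)
  moreover have "bar modulus dvd bar p - bar q"
    using assms by (auto simp: eqv_def bar_def pcompose_mult simp flip: pcompose_diff elim!: dvdE)
  ultimately show ?thesis
    by (auto simp: eqv_def intro: dvd_trans)
qed

lemma pcompose_cong_right:
  assumes "a \<approx> b"
  shows "pcompose p a \<approx> pcompose p b"
  by (induction p) (auto simp: pcompose_pCons intro!: eqv_add eqv_mult assms)

text \<open>Both \<open>bar Y\<close> and \<open>X\<close> are inverse to \<open>Y\<close> in the
  quotient, so they are congruent; composing \<open>p\<close> with them gives the claim.\<close>

lemma bar_bar: "bar (bar p) \<approx> p"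
proof -
  have "bar Y \<approx> bar Y * (X * Y)"
    using eqv_mult[OF eqv_refl[of "bar Y"] eqv_sym[OF X_Y]] by simp
  also have "\<dots> = X * bar (Y * X)"
    by (simp add: bar_mult)
  also have "\<dots> \<approx> X * bar 1"
    using X_Y by (intro eqv_mult bar_cong) (simp_all add: mult.commute)
  finally have "pcompose Y Y \<approx> X" by (simp add: bar_def pcompose_1)
  from pcompose_cong_right[OF this, of p] show ?thesis
    by (simp add: bar_def X_def monom_altdef flip: pcompose_assoc)
qed

text \<open>The constant coefficient of \<open>w * bar w\<close> is the sum of the squares of the coefficients
  of \<open>w\<close>, so that sum is \<open>1\<close>.\<close>

lemma unitary_imp_signed_monomial:
  assumes "w * bar w \<approx> 1"
  obtains c i where "c = 1 \<or> c = -1" "w \<approx> monom c i"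
proof -
  obtain r where r: "w \<approx> r" "degree r < N" by (rule eqv_reduce)
  define a where "a = coeff r"
  have r_sum: "r = (\<Sum>i<N. monom (a i) i)"
    using poly_as_sum_of_monoms'[of r "N - 1"] r(2) N_pos
    by (simp add: a_def lessThan_Suc_atMost[symmetric])
  \<comment> \<open>\<open>E i j\<close> is the reduced form of X^i Y^j. Off the diagonal its
    exponent lies strictly between 0 and \<open>N\<close>, so only the terms with i = j reach the
    constant coefficient.\<close>
  define E :: "nat \<Rightarrow> nat \<Rightarrow> int poly" where
    "E i j = (if j \<le> i then monom 1 (i - j) else monom (-1) (N + i - j))" for i j
  have E: "X ^ i * Y ^ j \<approx> E i j" if "j < N" for i j
    using X_Y_power_le[of j i] X_Y_power_less[of i j] that
    by (auto simp: E_def X_power minus_monom)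
  define S where "S = (\<Sum>i<N. \<Sum>j<N. smult (a i * a j) (E i j))"
  have "1 \<approx> w * bar w" by (rule eqv_sym[OF assms])
  also have "\<dots> \<approx> r * bar r" by (intro eqv_mult bar_cong r)
  also have "r * bar r = (\<Sum>i<N. \<Sum>j<N. smult (a i * a j) (X ^ i * Y ^ j))"
    by (subst (1 2) r_sum) 
       (simp add: bar_sum sum_product bar_monom X_power smult_monom_mult mult.commute)
  also have "\<dots> \<approx> S"
    unfolding S_def by (intro eqv_sum eqv_smult E) simp
  finally have "1 \<approx> S" .
  moreover have "degree S < N"
    unfolding S_def
    by (intro degree_sum_less N_pos le_less_trans[OF degree_smult_le])
       (auto simp: E_def intro: le_less_trans[OF degree_monom_le])
  ultimately have "S = 1"
    using N_pos by (intro eqv_imp_eq[symmetric]) auto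
  moreover have "coeff S 0 = (\<Sum>i<N. \<Sum>j<N. if i = j then a i * a j else 0)"
    unfolding S_def coeff_sum by (intro sum.cong refl) (auto simp: E_def)
  ultimately have "(\<Sum>i<N. (a i)\<^sup>2) = 1"
    by (simp add: power2_eq_square)
  then obtain i where i: "i < N" "a i = 1 \<or> a i = -1" "\<And>j. \<lbrakk>j < N; j \<noteq> i\<rbrakk> \<Longrightarrow> a j = 0"
    by (metis sum_squares_eq_1_int finite_lessThan lessThan_iff)
  have "r = (\<Sum>j<N. if j = i then monom (a i) i else 0)"
    unfolding r_sum using i(3) by (intro sum.cong) auto
  then have "r = monom (a i) i" using i(1) by simp
  then show ?thesis using that i(2) r(1) by simp
qed

section \<open>Congruences between sums of powers of X\<close>

lemma X_power_reduce: "X ^ e \<approx> monom ((-1) ^ (e div N)) (e mod N)"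
proof -
  have "X ^ e = (X ^ N) ^ (e div N) * X ^ (e mod N)"
    by (simp flip: power_mult power_add)
  also have "\<dots> \<approx> (-1) ^ (e div N) * X ^ (e mod N)"
    by (intro eqv_mult eqv_power X_power_N eqv_refl)
  also have "\<dots> = monom ((-1) ^ (e div N)) (e mod N)"
    by (cases "even (e div N)") (simp_all add: X_power minus_monom)
  finally show ?thesis .
qed

text \<open>As 3 divides \<open>N\<close>, reducing exponents modulo \<open>N\<close> keeps their
  residues modulo 3. Hence the term of \<open>a1\<close> can only be matched by that of
  \<open>b1\<close>, in position and in sign.\<close>

lemma three_powers_eq:
  assumes "X ^ a1 + X ^ a2 + X ^ a3 \<approx> X ^ b1 + X ^ b2 + X ^ b3"
    and "3 dvd N" "a1 mod 3 = b1 mod 3"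
    and "a1 mod 3 \<noteq> a2 mod 3" "a1 mod 3 \<noteq> a3 mod 3" "b1 mod 3 \<noteq> b2 mod 3" "b1 mod 3 \<noteq> b3 mod 3"
  shows "[a1 = b1] (mod 2 * N)"
proof -
  define R where "R e = monom ((-1 :: int) ^ (e div N)) (e mod N)" for e
  have deg: "degree (R e) < N" for e
    unfolding R_def using N_pos by (intro le_less_trans[OF degree_monom_le]) simp
  have "R a1 + R a2 + R a3 \<approx> X ^ a1 + X ^ a2 + X ^ a3"
    unfolding R_def by (intro eqv_add eqv_sym[OF X_power_reduce])
  also note assms(1)
  also have "X ^ b1 + X ^ b2 + X ^ b3 \<approx> R b1 + R b2 + R b3"
    unfolding R_def by (intro eqv_add X_power_reduce)
  finally have eq: "R a1 + R a2 + R a3 = R b1 + R b2 + R b3"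
    by (rule eqv_imp_eq) (intro degree_add_less deg)+
  have mod3: "e mod 3 = e' mod 3" if "e mod N = e' mod N" for e e' :: nat
    using that assms(2) by (metis mod_mod_cancel)
  then have neq: "a2 mod N \<noteq> a1 mod N" "a3 mod N \<noteq> a1 mod N"
    "b2 mod N \<noteq> a1 mod N" "b3 mod N \<noteq> a1 mod N"
    using mod3 assms(3-7) by metis+
  have "(-1 :: int) ^ (a1 div N) = (if b1 mod N = a1 mod N then (-1) ^ (b1 div N) else 0)"
    using arg_cong[OF eq, of "\<lambda>p. coeff p (a1 mod N)"] neq by (simp add: R_def)
  then have 1: "b1 mod N = a1 mod N" and 2: "even (a1 div N) \<longleftrightarrow> even (b1 div N)"
    by (auto simp: minus_one_power_iff split: if_splits)
  \<comment> \<open>The sign of a reduced power records the parity of \<open>e div N\<close>;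
    together with \<open>e mod N\<close> it determines \<open>e\<close> modulo 2N.\<close>
  have "e mod (2 * N) = N * (e div N mod 2) + e mod N" for e
    by (simp add: mult.commute[of 2] mod_mult2_eq)
  then show ?thesis
    using 1 2 by (simp add: cong_def) (metis parity_cases)
qed

lemma cyclotomic_in_trinomial_ideal:
  assumes N: "3 dvd N" and m: "m mod 6 = 2" "m < 2 * N"
    and comb: "1 + X + X ^ 2 = modulus * p + (1 + X + X ^ m) * q"
  shows "m = 2"
proof -
  obtain k where k: "N = 3 * k" using N ..
  define F where "F = 1 + X + X ^ m"
  define \<Phi> where "\<Phi> = 1 + X + X ^ 2"
  \<comment> \<open>X^3 - 1 is a multiple of 1 + X + X^2. This serves twice: to split
    \<open>F\<close>, and to make \<open>\<Phi>\<close> a divisor of X^N - 1.\<close>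
  have cube: "\<Phi> dvd X ^ (3 * j) - 1" for j
  proof -
    have "\<Phi> * (X - 1) dvd (\<Phi> * (X - 1)) * (\<Sum>i<j. (X ^ 3) ^ i)" by (rule dvd_triv_left)
    also have "\<Phi> * (X - 1) = X ^ 3 - 1"
      by (simp add: \<Phi>_def algebra_simps power2_eq_square power3_eq_cube)
    also have "(X ^ 3 - 1) * (\<Sum>i<j. (X ^ 3) ^ i) = X ^ (3 * j) - 1"
      by (simp only: power_diff_1_eq power_mult)
    finally show ?thesis
      using \<open>\<Phi> * (X - 1) = X ^ 3 - 1\<close> by (metis dvd_mult_left)
  qed
  obtain j where j: "m = 3 * j + 2"
  proof
    show "m = 3 * (m div 3) + 2" using m(1) by presburger
  qed
  have "F = \<Phi> + X ^ 2 * (X ^ (3 * j) - 1)"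
    by (simp add: F_def \<Phi>_def j power_add power2_eq_square algebra_simps)
  then have "\<Phi> dvd F" using cube[of j] by simp
  then obtain g where g: "F = \<Phi> * g" ..
  obtain s where s: "X ^ N - 1 = \<Phi> * s" using cube[of k] unfolding k by (elim dvdE)
  have Phi_F: "\<Phi> \<approx> F * q"
    using comb by (simp add: eqv_def \<Phi>_def F_def)
  \<comment> \<open>\<open>\<Phi>\<close> is cancelled by multiplying with its cofactor
    \<open>s\<close> in X^N - 1, which is congruent to -2, and then cancelling the integer
    -2.\<close>
  have gq: "g * q \<approx> 1"
  proof (rule eqv_cancel_smult)
    have s2: "s * \<Phi> \<approx> -2"
      using eqv_add[OF X_power_N eqv_refl[of "-1"]] s by (simp add: mult.commute)
    have "smult (-2) (g * q) = -2 * (g * q)" by (simp add: numeral_poly)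
    also have "\<dots> \<approx> s * \<Phi> * (g * q)" by (intro eqv_mult eqv_sym[OF s2] eqv_refl)
    also have "\<dots> = s * (F * q)" by (simp add: g mult_ac)
    also have "\<dots> \<approx> s * \<Phi>" by (intro eqv_mult eqv_sym[OF Phi_F] eqv_refl)
    also note s2
    also have "-2 = smult (-2) (1 :: int poly)" by (simp add: numeral_poly)
    finally show "smult (-2) (g * q) \<approx> smult (-2) 1" .
  qed simp
  \<comment> \<open>Since \<open>q\<close> inverts \<open>g\<close>, the product
    \<open>bar g * q\<close> is the unit bar g / g, and its image under the involution is its
    inverse.\<close>
  have "(bar g * q) * bar (bar g * q) = bar (bar g) * q * bar (g * q) "
    by (simp add: bar_mult mult_ac)
  also have "\<dots> \<approx> g * q * bar 1"
    by (intro eqv_mult bar_cong gq bar_bar eqv_refl)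
  also have "\<dots> \<approx> 1" using gq by simp
  finally obtain c i where c: "c = 1 \<or> c = -1" and W: "bar g * q \<approx> monom c i"
    by (rule unitary_imp_signed_monomial)
  have bar_Phi: "bar \<Phi> \<approx> Y ^ 2 * \<Phi>"
  proof -
    have "bar \<Phi> = Y ^ 2 + Y * 1 + 1" by (simp add: \<Phi>_def bar_add bar_power)
    also have "\<dots> \<approx> Y ^ 2 + Y * (X * Y) + X ^ 2 * Y ^ 2"
      by (intro eqv_add eqv_mult eqv_refl eqv_sym[OF X_Y] eqv_sym[OF X_Y_power])
    also have "\<dots> = Y ^ 2 * \<Phi>" by (simp add: \<Phi>_def algebra_simps power2_eq_square)
    finally show ?thesis .
  qed
  \<comment> \<open>Squaring removes the sign of \<open>Y\<close>, so this is an equality of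
    polynomials.\<close>
  have Y2: "Y ^ 2 = X ^ (2 * N - 2)"
    by (simp add: Y_def X_power monom_power diff_mult_distrib2 mult.commute[of _ 2])
  \<comment> \<open>\<open>J\<close> collects the exponents of X^m, of Y^2 and of the monomial; a
    sign -1 is absorbed as X^N.\<close>
  define J where "J = m + (2 * N - 2) + i + (if c = 1 then 0 else N)"
  have cX: "monom c i \<approx> X ^ (i + (if c = 1 then 0 else N))"
    using c eqv_mult[OF eqv_refl[of "X ^ i"] eqv_sym[OF X_power_N]]
    by (auto simp: X_power power_add minus_monom mult_monom)
  \<comment> \<open>The left side is the image of \<open>F\<close> under the involution, multiplied
    by X^m to clear negative exponents.\<close>
  have "X ^ m + X ^ (m - 1) + X ^ 0 \<approx> X ^ m * 1 + X ^ m * Y ^ 1 + X ^ m * Y ^ m"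
    using j X_Y_power_le[of 1 m] X_Y_power[of m]
    by (intro eqv_add eqv_sym[of "X ^ m * Y ^ 1"] eqv_sym[of "X ^ m * Y ^ m"]) auto
  also have "\<dots> = X ^ m * (bar \<Phi> * bar g)"
    by (simp add: bar_add bar_power F_def algebra_simps flip: bar_mult g)
  also have "\<dots> \<approx> X ^ m * ((Y ^ 2 * \<Phi>) * bar g)"
    by (intro eqv_mult bar_Phi eqv_refl)
  also have "\<dots> \<approx> X ^ m * ((Y ^ 2 * (F * q)) * bar g)"
    by (intro eqv_mult Phi_F eqv_refl)
  also have "\<dots> = X ^ m * Y ^ 2 * F * (bar g * q)"
    by (simp add: mult_ac)
  also have "\<dots> \<approx> X ^ m * Y ^ 2 * F * X ^ (i + (if c = 1 then 0 else N))"
    by (intro eqv_mult eqv_refl eqv_trans[OF W cX])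
  also have "\<dots> = X ^ J * F"
    by (simp add: Y2 J_def power_add mult_ac)
  also have "\<dots> = X ^ J + X ^ (J + 1) + X ^ (J + m)"
    by (simp add: F_def algebra_simps power_add)
  finally have main: "X ^ m + X ^ (m - 1) + X ^ 0 \<approx> X ^ J + X ^ (J + 1) + X ^ (J + m)" .
  have m3: "m mod 3 = 2" "m \<ge> 2" "even m" using m(1) by presburger+
  have res: "(m - 1) mod 3 = 1" "(m - Suc 0) mod 3 = 1" "Suc J mod 3 = Suc (J mod 3) mod 3" "(J + m) mod 3 = (J mod 3 + 2) mod 3"
    using j m3(1) mod_add_eq[of J 3 m] by (simp_all add: mod_simps)
  \<comment> \<open>On each side the three exponents have distinct residues modulo 3, so the residue
    of \<open>J\<close> decides which terms match. Residue 0 forces \<open>m = 2\<close>; the other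
    two contradict the evenness of \<open>m\<close>.\<close>
  consider "J mod 3 = 0" | "J mod 3 = 1" | "J mod 3 = 2" by linarith
  then show ?thesis
  proof cases
    case 1
    have "[0 = J] (mod 2 * N)"
      by (rule three_powers_eq[of 0 m "m - 1" J "J + 1" "J + m"])
        (use main in \<open>simp only: add_ac\<close>, rule N, simp_all add: res m3 1)
    moreover have "[m - 1 = J + 1] (mod 2 * N)"
      by (rule three_powers_eq[of "m - 1" m 0 "J + 1" J "J + m"])
        (use main in \<open>simp only: add_ac\<close>, rule N, simp_all add: res m3 1)
    ultimately have "[m - 1 = 0 + 1] (mod 2 * N)"
      using cong_add[OF cong_sym, of 0 J "2 * N" 1 1] by (auto intro: cong_trans)
    then show ?thesis using m m3 by (auto simp: cong_def)
  next
    case 2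
    have "[m - 1 = J] (mod 2 * N)"
      by (rule three_powers_eq[of "m - 1" m 0 J "J + 1" "J + m"])
        (use main in \<open>simp only: add_ac\<close>, rule N, simp_all add: res m3 2)
    moreover have "[0 = J + m] (mod 2 * N)"
      by (rule three_powers_eq[of 0 m "m - 1" "J + m" "J + 1" J])
        (use main in \<open>simp only: add_ac\<close>, rule N, simp_all add: res m3 2)
    ultimately have "[m - 1 = J] (mod 2)" "[0 = J + m] (mod 2)"
      by (auto intro: cong_dvd_modulus_nat)
    then show ?thesis using m3 by (auto simp: cong_def; presburger)
  next
    case 3
    have "[m = J] (mod 2 * N)"
      by (rule three_powers_eq[of m "m - 1" 0 J "J + 1" "J + m"])
        (use main in \<open>simp only: add_ac\<close>, rule N, simp_all add: res m3 3)
    moreover have "[0 = J + 1] (mod 2 * N)"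
      by (rule three_powers_eq[of 0 m "m - 1" "J + 1" J "J + m"])
        (use main in \<open>simp only: add_ac\<close>, rule N, simp_all add: res m3 3)
    ultimately have "[m = J] (mod 2)" "[0 = J + 1] (mod 2)"
      by (auto intro: cong_dvd_modulus_nat)
    then show ?thesis using m3 by (auto simp: cong_def; presburger)
  qed
qed

end

section \<open>Characterization of the rank two free case\<close>

text \<open>Only the additive structure is packaged as a record: it is what the factor group and its
  cosets need.\<close>

definition poly_group :: "int poly monoid" where
  "poly_group = \<lparr>carrier = UNIV, monoid.mult = (+), one = 0\<rparr>"

lemma poly_group_simps [simp]:
  "carrier poly_group = UNIV" "p \<otimes>\<^bsub>poly_group\<^esub> q = p + q" "\<one>\<^bsub>poly_group\<^esub> = 0"
  by (simp_all add: poly_group_def)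

lemma comm_group_poly_group: "comm_group poly_group"
proof (rule comm_groupI)
  show "\<exists>q\<in>carrier poly_group. q \<otimes>\<^bsub>poly_group\<^esub> p = \<one>\<^bsub>poly_group\<^esub>" for p
    by (auto intro: exI[of _ "- p"])
qed (auto simp: algebra_simps)

interpretation poly_group: comm_group poly_group
  by (rule comm_group_poly_group)

lemma inv_poly_group [simp]: "inv\<^bsub>poly_group\<^esub> p = - p"
  by (rule poly_group.inv_equality) auto

definition ideal2 :: "int poly \<Rightarrow> int poly \<Rightarrow> int poly set" where
  "ideal2 f g = {f * p + g * q |p q. True}"

lemma ideal2I: "c = f * p + g * q \<Longrightarrow> c \<in> ideal2 f g"
  by (auto simp: ideal2_def)

lemma subgroup_ideal2: "subgroup (ideal2 f g) poly_group"
proof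
  fix a b assume "a \<in> ideal2 f g" "b \<in> ideal2 f g"
  then obtain p q r s where ab: "a = f * p + g * q" "b = f * r + g * s" by (auto simp: ideal2_def)
  show "a \<otimes>\<^bsub>poly_group\<^esub> b \<in> ideal2 f g"
    by (rule ideal2I[of _ _ "p + r" _ "q + s"]) (simp add: ab algebra_simps)
  show "inv\<^bsub>poly_group\<^esub> a \<in> ideal2 f g"
    by (rule ideal2I[of _ _ "- p" _ "- q"]) (simp add: ab)
next
  show "\<one>\<^bsub>poly_group\<^esub> \<in> ideal2 f g"
    by (rule ideal2I[of _ _ 0 _ 0]) simp
qed simp

lemma coset_ideal2_eq_iff:
  "ideal2 f g #>\<^bsub>poly_group\<^esub> a = ideal2 f g #>\<^bsub>poly_group\<^esub> b \<longleftrightarrow> a - b \<in> ideal2 f g"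
proof -
  interpret I: subgroup "ideal2 f g" poly_group by (rule subgroup_ideal2)
  have "a \<in> ideal2 f g #>\<^bsub>poly_group\<^esub> b \<longleftrightarrow> a - b \<in> ideal2 f g"
    using I.rcos_module[of b a] by (simp add: poly_group.is_group)
  then show ?thesis
    using poly_group.repr_independence[of a "ideal2 f g" b] poly_group.rcos_self[of a "ideal2 f g"]
      subgroup_ideal2 by auto
qed

section \<open>The two implications for an isomorphism with Z^2\<close>

context gilbert_howie_ab
begin

text \<open>Sending \<open>x i\<close> to the class of (-X)^i respects the relations: X^N + 1
  divides X^n - 1, and \<open>m\<close> is even. The dependence between \<open>x 0\<close>,
  \<open>x 1\<close> and \<open>x 2\<close> is then read off in the quotient by the ideal.\<close>

lemma gen_dependence_imp_ideal:
  fixes X :: "int poly"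
  assumes n: "n = 2 * N" and m: "even m"
    and dep: "x 0 \<otimes>\<^bsub>H\<^esub> x 2 = x 1"
  shows "1 + X + X ^ 2 \<in> ideal2 (X ^ N + 1) (1 + X + X ^ m)"
proof -
  define I where "I = ideal2 (X ^ N + 1) (1 + X + X ^ m)"
  define b where "b i = I #>\<^bsub>poly_group\<^esub> (- X) ^ i" for i
  have I: "I \<lhd> poly_group"
    unfolding I_def by (rule poly_group.subgroup_imp_normal[OF subgroup_ideal2])
  have mult: "(I #>\<^bsub>poly_group\<^esub> p) <#>\<^bsub>poly_group\<^esub> (I #>\<^bsub>poly_group\<^esub> q) = I #>\<^bsub>poly_group\<^esub> (p + q)"
    for p q using normal.rcos_sum[OF I, of p q] by simp
  have eq_iff: "I #>\<^bsub>poly_group\<^esub> p = I #>\<^bsub>poly_group\<^esub> q \<longleftrightarrow> p - q \<in> I" for p q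
    unfolding I_def by (rule coset_ideal2_eq_iff)
  have "comm_group (poly_group Mod I)"
    using poly_group.abelian_FactGroup[of I] subgroup_ideal2 by (simp add: I_def)
  moreover have "b i \<in> carrier (poly_group Mod I)" for i
    by (simp add: b_def carrier_FactGroup)
  moreover have "b (i mod n) = b i" for i
  proof -
    have "X ^ N + 1 dvd X ^ n - 1"
    proof
      show "X ^ n - 1 = (X ^ N + 1) * (X ^ N - 1)"
        by (simp add: n algebra_simps flip: power_add mult_2)
    qed
    also have "X ^ n - 1 dvd (X ^ n) ^ (i div n) - 1"
      by (simp only: power_diff_1_eq dvd_triv_left)
    finally obtain s where s: "(X ^ n) ^ (i div n) - 1 = (X ^ N + 1) * s" ..
    have "(- X) ^ i = ((- X) ^ n) ^ (i div n) * (- X) ^ (i mod n)"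
      by (simp flip: power_mult power_add)
    also have "(- X) ^ n = X ^ n" by (simp add: n)
    finally have "(- X) ^ (i mod n) - (- X) ^ i = - (((X ^ n) ^ (i div n) - 1) * (- X) ^ (i mod n))"
      by (simp add: algebra_simps)
    also have "\<dots> = (X ^ N + 1) * (- s * (- X) ^ (i mod n)) + (1 + X + X ^ m) * 0"
      unfolding s by (simp add: mult_ac)
    finally show ?thesis
      unfolding b_def eq_iff unfolding I_def by (rule ideal2I)
  qed
  moreover have "b i \<otimes>\<^bsub>poly_group Mod I\<^esub> b (i + m) = b (i + 1)" for i
  proof -
    have "(- X) ^ i + (- X) ^ (i + m) - (- X) ^ (i + 1) = (X ^ N + 1) * 0 + (1 + X + X ^ m) * (- X) ^ i"
      using m by (simp add: power_add algebra_simps)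
    then show ?thesis
      unfolding b_def mult_FactGroup mult eq_iff unfolding I_def by (rule ideal2I)
  qed
  ultimately obtain h where h: "h \<in> hom H (poly_group Mod I)" "\<And>i. h (x i) = b i"
    by (rule gen_universal) blast
  have "b 0 \<otimes>\<^bsub>poly_group Mod I\<^esub> b 2 = b 1"
    using arg_cong[OF dep, of h] hom_mult[OF h(1) gen_closed gen_closed] by (simp add: h(2))
  then have "1 + X ^ 2 + X \<in> I"
    unfolding b_def mult_FactGroup mult eq_iff by simp
  then show ?thesis by (simp add: I_def add_ac)
qed

text \<open>The index shift becomes an integer matrix, and Cayley-Hamilton makes both coordinates of
  the images of the generators satisfy one quadratic recurrence, which turns out to be that of t^2 -
  t + 1.\<close>

lemma iso_imp_dependence:
  assumes "H \<cong> integer_group \<times>\<times> integer_group"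
  shows "6 dvd n" "m mod 6 = 2" "x 0 \<otimes>\<^bsub>H\<^esub> x 2 = x 1"
proof -
  let ?Z = "integer_group \<times>\<times> integer_group"
  obtain f where f: "f \<in> iso H ?Z" using assms by (auto simp: is_iso_def)
  define g where "g = inv_into (carrier H) f"
  have f_hom: "f \<in> hom H ?Z" and f_bij: "bij_betw f (carrier H) (carrier ?Z)"
    using f by (auto simp: iso_def)
  have g_hom: "g \<in> hom ?Z H"
    using H.iso_set_sym[OF f] by (simp add: iso_def g_def)
  have gf: "g (f z) = z" if "z \<in> carrier H" for z
    using f_bij that by (simp add: g_def bij_betw_def)
  obtain T where T: "T \<in> hom H H" "\<And>i. T (x i) = x (i + 1)"
  proof (rule gen_universal[of H "\<lambda>i. x (i + 1)"])
    show "x (i mod n + 1) = x (i + 1)" for i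
      by (rule gen_cong) (simp add: cong_def mod_simps)
    show "x (i + 1) \<otimes>\<^bsub>H\<^esub> x (i + m + 1) = x (i + 1 + 1)" for i
      using gen_relation[of "i + 1"] by (simp add: add_ac)
  qed (use H.comm_group_axioms in auto)
  define S where "S = f \<circ> T \<circ> g"
  have "S \<in> hom ?Z ?Z"
    unfolding S_def comp_assoc by (intro hom_compose[OF hom_compose[OF g_hom T(1)] f_hom, unfolded comp_assoc])
  then obtain p q r s where S: "\<And>a b. S (a, b) = (p * a + q * b, r * a + s * b)"
    by (rule hom_integer_group_square) blast
  define u where "u i = f (x i)" for i
  have "S (u i) = u (i + 1)" for i
    by (simp add: S_def u_def gf T(2))
  then have step: "fst (u (i + 1)) = p * fst (u i) + q * snd (u i)"
    "snd (u (i + 1)) = r * fst (u i) + s * snd (u i)" for i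
    using S[of "fst (u i)" "snd (u i)"] by simp_all
  have rel: "fst (u i) + fst (u (i + m)) = fst (u (i + 1))" 
    "snd (u i) + snd (u (i + m)) = snd (u (i + 1))" for i
    using hom_mult[OF f_hom, of "x i" "x (i + m)"] gen_relation[of i]
    by (simp_all add: u_def mult_DirProd')
  \<comment> \<open>Trace and determinant of the shift matrix.\<close>
  define a d where "a = p + s" and "d = p * s - q * r"
  have rec: "fst (u (i + 2)) = a * fst (u (i + 1)) - d * fst (u i)"
    "snd (u (i + 2)) = a * snd (u (i + 1)) - d * snd (u i)" for i
    using step[of i] step[of "i + 1"] by (simp_all add: a_def d_def algebra_simps)
  \<comment> \<open>If it vanished, linearity of the shift would send every generator to 0,
    contradicting surjectivity of \<open>f\<close>.\<close>
  have "u 0 \<noteq> (0, 0)"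
  proof
    assume u0: "u 0 = (0, 0)"
    have "f (x i) = (0, 0)" for i
    proof (induction i)
      case (Suc i)
      then show ?case using step[of i] by (simp add: u_def prod_eq_iff)
    qed (use u0 in \<open>simp add: u_def\<close>)
    moreover have "(\<lambda>_. (0, 0)) \<in> hom H ?Z" by (auto intro: homI)
    ultimately have "f z = (0, 0)" if "z \<in> carrier H" for z
      using that f_hom by (intro gen_hom_eqI[of ?Z f "\<lambda>_. (0, 0)" z]) (simp_all add: DirProd_group)
    then have "f ` carrier H \<subseteq> {(0, 0)}" by auto
    moreover have "(1, 0) \<in> f ` carrier H"
      using f_bij by (simp add: bij_betw_def)
    ultimately show False by auto
  qed
  then have "fst (u 0) \<noteq> 0 \<or> snd (u 0) \<noteq> 0"
    by (auto simp: prod_eq_iff)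
  \<comment> \<open>One nonzero coordinate suffices, because \<open>a\<close> and \<open>d\<close>
    are common to both.\<close>
  then have main: "a = 1 \<and> d = 1 \<and> 6 dvd n \<and> m mod 6 = 2"
  proof
    assume "fst (u 0) \<noteq> 0"
    then show ?thesis
      using periodic_trinomial_recurrence[of "\<lambda>i. fst (u i)" a d n m] rec(1) rel(1) n_pos
      by (simp add: u_def gen_period)
  next
    assume "snd (u 0) \<noteq> 0"
    then show ?thesis
      using periodic_trinomial_recurrence[of "\<lambda>i. snd (u i)" a d n m] rec(2) rel(2) n_pos
      by (simp add: u_def gen_period)
  qed
  then show "6 dvd n" "m mod 6 = 2" by auto
  have "f (x 0 \<otimes>\<^bsub>H\<^esub> x 2) = f (x 1)"
    using hom_mult[OF f_hom, of "x 0" "x 2"] rec[of 0] main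
    by (simp add: u_def mult_DirProd' prod_eq_iff numeral_2_eq_2)
  then show "x 0 \<otimes>\<^bsub>H\<^esub> x 2 = x 1"
    using gf[of "x 0 \<otimes>\<^bsub>H\<^esub> x 2"] gf[of "x 1"] by simp
qed

lemma iso_imp_m_eq_2:
  assumes m: "m < n" and iso: "H \<cong> integer_group \<times>\<times> integer_group"
  shows "6 dvd n" "m = 2"
proof -
  note dep = iso_imp_dependence[OF iso]
  show "6 dvd n" by (rule dep)
  then obtain k where k: "n = 6 * k" ..
  \<comment> \<open>\<open>3 * k\<close> is n / 2, so that \<open>m < n\<close> becomes the bound by
    2N and 3 divides N.\<close>
  then interpret N: negacyclic "3 * k" using n_pos by unfold_locales simp
  have modulus: "N.modulus = N.X ^ (3 * k) + 1"
    by (simp only: N.modulus_def N.X_power)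
  have "even m" using dep(2) by presburger
  moreover have "n = 2 * (3 * k)" using k by simp
  ultimately have "1 + N.X + N.X ^ 2 \<in> ideal2 N.modulus (1 + N.X + N.X ^ m)"
    unfolding modulus using dep(3) by (intro gen_dependence_imp_ideal)
  then obtain p q where "1 + N.X + N.X ^ 2 = N.modulus * p + (1 + N.X + N.X ^ m) * q"
    unfolding ideal2_def by blast
  then show "m = 2"
    by (rule N.cyclotomic_in_trinomial_ideal[rotated 3]) (use dep(2) m k in simp_all)
qed

lemma iso_if_m_eq_2:
  assumes n: "6 dvd n" and m: "m = 2"
  shows "H \<cong> integer_group \<times>\<times> integer_group"
proof -
  let ?Z = "integer_group \<times>\<times> integer_group"
  \<comment> \<open>The solution of c (i + 2) = c (i + 1) - c i starting at the two unit vectors; it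
    has period 6 and hence period \<open>n\<close>.\<close>
  define c :: "nat \<Rightarrow> int \<times> int" where
    "c i = [(1, 0), (0, 1), (-1, 1), (-1, 0), (0, -1), (1, -1)] ! (i mod 6)" for i
  have Z: "comm_group ?Z"
    using abelian_integer_group
    by (intro group.group_comm_groupI DirProd_group) (auto simp: comm_group_def)
  have six: "i mod 6 \<in> {0, 1, 2, 3, 4, 5}" for i :: nat by auto
  have c_rel: "c i \<otimes>\<^bsub>?Z\<^esub> c (i + 2) = c (i + 1)" for i
    using six[of i] mod_add_left_eq[of i 6 2, symmetric] mod_add_left_eq[of i 6 1, symmetric]
    by (auto simp: c_def)
  obtain f where f: "f \<in> hom H ?Z" "\<And>i. f (x i) = c i"
  proof (rule gen_universal[OF Z, of c])
    show "c (i mod n) = c i" for i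
      using n by (simp add: c_def mod_mod_cancel)
  qed (use c_rel m in auto)
  define g where "g = (\<lambda>(a :: int, b :: int). x 0 [^]\<^bsub>H\<^esub> a \<otimes>\<^bsub>H\<^esub> x 1 [^]\<^bsub>H\<^esub> b)"
  have g: "g \<in> hom ?Z H"
    by (rule homI) (auto simp: g_def H.int_pow_mult H.m_ac)
  \<comment> \<open>For \<open>m = 2\<close> the relation determines \<open>x (j + 2)\<close> from
    \<open>x j\<close> and \<open>x (j + 1)\<close>, after cancelling \<open>x j\<close>.\<close>
  have gc: "g (c i) = x i" for i
  proof (induction i rule: nat_less_induct)
    case (1 i)
    show ?case
    proof (cases "i < 2")
      case True
      then show ?thesis by (auto simp: less_2_cases_iff c_def g_def H.int_pow_1)
    next
      case False
      then obtain j where j: "i = j + 2" by (metis add.commute le_Suc_ex not_less)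
      have "x j \<otimes>\<^bsub>H\<^esub> g (c (j + 2)) = g (c j \<otimes>\<^bsub>?Z\<^esub> c (j + 2))"
        using hom_mult[OF g, of "c j" "c (j + 2)"] 1 j by simp
      also have "\<dots> = x (j + 1)" unfolding c_rel using 1 j by simp
      also have "\<dots> = x j \<otimes>\<^bsub>H\<^esub> x (j + 2)" using gen_relation[of j] m by simp
      finally show ?thesis
        using hom_in_carrier[OF g, of "c (j + 2)"] H.Units_eq H.Units_l_cancel[of "x j"] j by simp
    qed
  qed
  have "g (f z) = z" if "z \<in> carrier H" for z
    using gen_hom_eqI[of H "g \<circ> f" "\<lambda>z. z" z] that hom_compose[OF f(1) g]
    by (simp add: f(2) gc H.is_group hom_def Pi_iff)
  \<comment> \<open>\<open>c 0\<close> and \<open>c 1\<close> are the unit vectors and are fixed, so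
    the matrix of the composite is the identity.\<close>
  moreover have "f (g z) = z" for z
  proof -
    obtain p q r s where fg: "\<And>a b. (f \<circ> g) (a, b) = (p * a + q * b, r * a + s * b)"
      using hom_integer_group_square[OF hom_compose[OF g f(1)]] by blast
    have "f (g (c 0)) = c 0" "f (g (c 1)) = c 1" by (simp_all add: gc f(2))
    then have "p = 1" "q = 0" "r = 0" "s = 1"
      using fg[of 1 0] fg[of 0 1] by (simp_all add: c_def)
    then show ?thesis using fg by (cases z) simp
  qed
  ultimately have "bij_betw f (carrier H) (carrier ?Z)"
    using hom_in_carrier[OF f(1)] hom_in_carrier[OF g]
    by (intro bij_betwI[of f _ _ g]) auto
  then show ?thesis using f(1) by (auto simp: is_iso_def iso_def)
qed

end

theorem theorem4p1:
  fixes n m :: nat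
  assumes "n \<ge> 1" and "m < n"
  shows "abelianization (gilbert_howie n m) \<cong> integer_group \<times>\<times> integer_group
    \<longleftrightarrow> [n = 0] (mod 6) \<and> [m = 2] (mod n)"
proof -
  interpret gilbert_howie_ab n m by unfold_locales (rule assms(1))
  show ?thesis
  proof
    assume "H \<cong> integer_group \<times>\<times> integer_group"
    from iso_imp_m_eq_2[OF assms(2) this] show "[n = 0] (mod 6) \<and> [m = 2] (mod n)"
      by (simp add: cong_0_iff)
  next
    assume "[n = 0] (mod 6) \<and> [m = 2] (mod n)"
    then have n: "6 dvd n" and m: "[m = 2] (mod n)" by (simp_all add: cong_0_iff)
    \<comment> \<open>This makes 2 a reduced residue modulo \<open>n\<close>, which turns the
      congruence into an equality.\<close>
    have "n \<ge> 6" using dvd_imp_le[OF n] assms(1) by simp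
    then have "m = 2" using m assms(2) by (simp add: cong_def)
    with n show "H \<cong> integer_group \<times>\<times> integer_group" by (rule iso_if_m_eq_2)
  qed
qed

end
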